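(* Let $d\geq 2$ be an integer. For each $j\in\{0,\ldots,d-1\}$, the sum $$\binom nj+\binom n{j+d}+\binom n{j+2d}+\cdots$$ is asymptotically equal to $2^n/d$ as $n\rightarrow\infty$; that is, $$\lim_{n\rightarrow\infty}\frac{\sum_{i\geq 0}\binom{n}{j+id}}{2^n/d}=1.$$
   Context: $\binom nk$ denotes the binomial coefficient, with $\binom nk=0$ for $k>n$, so the sums are finite. Two sequences are asymptotically equal if their ratio tends to $1$. *)

theory Defs
  imports Complex_Main
begin

end

theory Submission
  imports Defs
begin

text \<open>Roots of unity filter: with \<open>w = exp (2 \<pi> \<i> / d)\<close>, the sum times \<open>d\<close> is
  \<open>\<Sum>k<d. w\<^sup>-\<^sup>k\<^sup>j (1 + w\<^sup>k)\<^sup>n\<close>. After division by \<open>2\<^sup>n\<close> the term \<open>k = 0\<close> is \<open>1\<close>, and the other terms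
  decay geometrically because \<open>\<bar>1 + w\<^sup>k\<bar> < 2\<close>. To avoid negative exponents, \<open>-j\<close> is
  replaced by \<open>d - j\<close>.\<close>

text \<open>Since \<open>j < d\<close>, the condition \<open>d dvd m + (d - j)\<close> encodes that
  \<open>m\<close> is congruent to \<open>j\<close> modulo \<open>d\<close> without subtracting from
  \<open>m\<close>. In this form the root-of-unity sum can detect it.\<close>

lemma suminf_choose_progression:
  fixes d j n :: nat
  assumes "j < d"
  shows "(\<Sum>i. real (n choose (j + i * d))) =
         (\<Sum>m\<le>n. if d dvd m + (d - j) then real (n choose m) else 0)"
proof -
  have "(\<Sum>i. real (n choose (j + i * d))) = (\<Sum>i\<le>n. real (n choose (j + i * d)))"
  proof (rule suminf_finite)
    fix i assume "i \<notin> {..n}"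
    then have "n < i * 1" by simp
    also have "i * 1 \<le> i * d" using assms by (intro mult_le_mono) auto
    finally show "real (n choose (j + i * d)) = 0" by (simp add: binomial_eq_0)
  qed simp
  also have "\<dots> = (\<Sum>m\<in>(\<lambda>i. j + i * d) ` {..n}. real (n choose m))"
    using assms by (subst sum.reindex) (auto simp: inj_on_def)
  \<comment> \<open>The progression overshoots \<open>n\<close>, but the binomial coefficients
    vanish there.\<close>
  also have "\<dots> = (\<Sum>m\<in>{m\<in>{..n}. d dvd m + (d - j)}. real (n choose m))"
  proof (rule sum.mono_neutral_right)
    show "{m\<in>{..n}. d dvd m + (d - j)} \<subseteq> (\<lambda>i. j + i * d) ` {..n}"
    proof
      fix m assume "m \<in> {m\<in>{..n}. d dvd m + (d - j)}"
      then have m: "m \<le> n" "d dvd m + (d - j)" by auto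
      then obtain q where q: "m + (d - j) = d * q" by auto
      \<comment> \<open>The summand \<open>d - j\<close> is positive and contributes one extra
        multiple of \<open>d\<close>, so the index in the progression is
        \<open>q - 1\<close>.\<close>
      with assms have "q \<noteq> 0" by (cases q) auto
      then obtain i where i: "q = Suc i" by (cases q) auto
      with q assms have mi: "m = j + i * d" by (simp add: mult.commute)
      moreover have "i * 1 \<le> i * d" using assms by (intro mult_le_mono) auto
      then have "i \<le> n" using mi m(1) by linarith
      ultimately show "m \<in> (\<lambda>i. j + i * d) ` {..n}" by blast
    qed
    show "\<forall>m\<in>(\<lambda>i. j + i * d) ` {..n} - {m\<in>{..n}. d dvd m + (d - j)}. real (n choose m) = 0"
    proof
      fix m assume m: "m \<in> (\<lambda>i. j + i * d) ` {..n} - {m\<in>{..n}. d dvd m + (d - j)}"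
      then obtain i where "m = j + i * d" by blast
      then have "m + (d - j) = Suc i * d" using assms by simp
      then have "d dvd m + (d - j)" by (metis dvd_triv_right)
      with m show "real (n choose m) = 0" by (simp add: binomial_eq_0)
    qed
  qed simp
  also have "\<dots> = (\<Sum>m\<le>n. if d dvd m + (d - j) then real (n choose m) else 0)"
    by (rule sum.inter_filter) simp
  finally show ?thesis .
qed

text \<open>Exponents matter only modulo \<open>d\<close>, and the powers with exponents below
  \<open>d\<close> are the distinct \<open>d\<close>-th roots of unity.\<close>

lemma cis_root_power_eq_1_iff:
  fixes d k :: nat
  assumes "d > 0"
  shows "cis (2 * pi / real d) ^ k = 1 \<longleftrightarrow> d dvd k"
proof -
  let ?w = "cis (2 * pi / real d)"
  have w: "?w ^ d = 1" using assms by (simp add: DeMoivre)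
  have pow: "?w ^ i = cis (2 * pi * real i / real d)" for i
    by (simp add: DeMoivre mult_ac)
  have "?w ^ k = ?w ^ (d * (k div d) + k mod d)" by simp
  also have "\<dots> = ?w ^ (k mod d)" by (simp only: power_add power_mult w power_one mult_1)
  finally have red: "?w ^ k = ?w ^ (k mod d)" .
  have "inj_on (\<lambda>i. ?w ^ i) {..<d}"
    using bij_betw_roots_unity[OF assms] by (simp add: pow bij_betw_def)
  then have "?w ^ (k mod d) = ?w ^ 0 \<longleftrightarrow> k mod d = 0"
    using assms by (subst inj_on_eq_iff) auto
  then show ?thesis using red by (simp add: dvd_eq_mod_eq_0)
qed

text \<open>With the exponents swapped this is a geometric sum of ratio \<open>?w ^ m\<close>. The
  \<open>d\<close>-th power of the ratio is 1, so the sum vanishes unless the ratio itself is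
  1.\<close>

lemma sum_cis_root_powers:
  fixes d m :: nat
  assumes "d > 0"
  shows "(\<Sum>k<d. (cis (2 * pi / real d) ^ k) ^ m) = (if d dvd m then of_nat d else 0)"
proof -
  let ?w = "cis (2 * pi / real d)"
  have swap: "(?w ^ k) ^ m = (?w ^ m) ^ k" for k
    by (simp only: power_mult[symmetric] mult.commute)
  have "(?w ^ m) ^ d = (?w ^ d) ^ m"
    by (simp only: power_mult[symmetric] mult.commute)
  also have "\<dots> = 1" using cis_root_power_eq_1_iff[OF assms, of d] by simp
  finally have "(?w ^ m) ^ d = 1" .
  then show ?thesis
    unfolding swap using cis_root_power_eq_1_iff[OF assms, of m]
    by (auto simp: geometric_sum)
qed

text \<open>On the unit circle the square of \<open>norm (1 + z)\<close> is
  \<open>2 + 2 * Re z\<close>, and \<open>Re z = 1\<close> only at \<open>z = 1\<close>.\<close>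

lemma norm_one_plus_less_2:
  fixes z :: complex
  assumes "norm z = 1" "z \<noteq> 1"
  shows "norm (1 + z) < 2"
proof -
  have sq: "(Re z)\<^sup>2 + (Im z)\<^sup>2 = 1" using assms(1) cmod_power2[of z] by simp
  have "Re z \<noteq> 1" using sq assms(2) by (auto simp: complex_eq_iff)
  moreover have "Re z \<le> 1" using complex_Re_le_cmod[of z] assms(1) by simp
  ultimately have "Re z < 1" by simp
  then have "(norm (1 + z))\<^sup>2 < 2\<^sup>2"
    using sq by (simp add: cmod_power2 power2_sum)
  then show ?thesis by (rule power2_less_imp_less) simp
qed

text \<open>The binomial theorem and an exchange of sums reduce this to
  \<open>sum_cis_root_powers\<close>. Dividing by \<open>2 ^ n\<close> inside the power makes each
  term a constant times a geometric sequence in \<open>n\<close>.\<close>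

lemma choose_progression_roots_of_unity:
  fixes d j n :: nat
  assumes "j < d"
  defines "w \<equiv> cis (2 * pi / real d)"
  shows "complex_of_real ((\<Sum>i. real (n choose (j + i * d))) / (2 ^ n / real d)) =
         (\<Sum>k<d. (w ^ k) ^ (d - j) * ((1 + w ^ k) / 2) ^ n)"
proof -
  have "(\<Sum>k<d. (w ^ k) ^ (d - j) * (1 + w ^ k) ^ n) =
        (\<Sum>k<d. \<Sum>m\<le>n. of_nat (n choose m) * (w ^ k) ^ (m + (d - j)))"
  proof (rule sum.cong[OF refl])
    fix k
    have "(1 + w ^ k) ^ n = (\<Sum>m\<le>n. of_nat (n choose m) * (w ^ k) ^ m)"
      using binomial_ring[of "w ^ k" 1 n] by (simp add: add.commute)
    then show "(w ^ k) ^ (d - j) * (1 + w ^ k) ^ n =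
               (\<Sum>m\<le>n. of_nat (n choose m) * (w ^ k) ^ (m + (d - j)))"
      by (simp only: power_add sum_distrib_left mult_ac)
  qed
  also have "\<dots> = (\<Sum>m\<le>n. of_nat (n choose m) * (\<Sum>k<d. (w ^ k) ^ (m + (d - j))))"
    by (subst sum.swap) (simp only: sum_distrib_left)
  also have "\<dots> = (\<Sum>m\<le>n. of_nat (n choose m) * (if d dvd m + (d - j) then of_nat d else 0))"
    unfolding w_def using assms(1) by (subst sum_cis_root_powers) auto
  also have "\<dots> = of_nat d * complex_of_real (\<Sum>i. real (n choose (j + i * d)))"
    unfolding suminf_choose_progression[OF assms(1)] of_real_sum sum_distrib_left
    by (rule sum.cong) auto
  finally have *: "(\<Sum>k<d. (w ^ k) ^ (d - j) * (1 + w ^ k) ^ n) =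
        of_nat d * complex_of_real (\<Sum>i. real (n choose (j + i * d)))" .
  have "(\<Sum>k<d. (w ^ k) ^ (d - j) * ((1 + w ^ k) / 2) ^ n) =
        (\<Sum>k<d. (w ^ k) ^ (d - j) * (1 + w ^ k) ^ n) / 2 ^ n"
    by (simp add: sum_divide_distrib power_divide)
  then show ?thesis unfolding * by (simp add: mult.commute)
qed

theorem mainTheorem2:
  fixes d j :: nat
  assumes "d \<ge> 2" and "j \<in> {0..d - 1}"
  shows "(\<lambda>n::nat. (\<Sum>i. real (n choose (j + i * d))) / (2 ^ n / real d)) \<longlonglongrightarrow> 1"
proof -
  define w where "w = cis (2 * pi / real d)"
  have jd: "j < d" using assms by auto
  have "(\<lambda>n. (w ^ k) ^ (d - j) * ((1 + w ^ k) / 2) ^ n) \<longlonglongrightarrow> (if k = 0 then 1 else 0)"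
    if "k < d" for k
  proof (cases "k = 0")
    case False
    with that have "\<not> d dvd k" by (auto dest: dvd_imp_le)
    then have "w ^ k \<noteq> 1" using cis_root_power_eq_1_iff[of d k] jd by (simp add: w_def)
    moreover have "norm (w ^ k) = 1" by (simp add: w_def norm_power)
    ultimately have "norm ((1 + w ^ k) / 2) < 1"
      using norm_one_plus_less_2 by (simp add: norm_divide)
    then have "(\<lambda>n. ((1 + w ^ k) / 2) ^ n) \<longlonglongrightarrow> 0" by (rule LIMSEQ_power_zero)
    then show ?thesis using False by (simp add: tendsto_mult_right_zero)
  qed simp
  then have "(\<lambda>n. \<Sum>k<d. (w ^ k) ^ (d - j) * ((1 + w ^ k) / 2) ^ n)
             \<longlonglongrightarrow> (\<Sum>k<d. if k = 0 then 1 else 0)"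
    by (intro tendsto_sum) auto
  \<comment> \<open>Writing the limit as an embedded real lets the complex convergence be read back
    as a real one.\<close>
  also have "(\<Sum>k<d. if k = 0 then 1 else 0) = complex_of_real 1" using jd by simp
  finally show ?thesis
    unfolding w_def choose_progression_roots_of_unity[OF jd, symmetric]
    by (simp only: tendsto_of_real_iff)
qed

end
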